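(* Let $n \geq 1$ and let $X_1, \ldots, X_n$ be independent standard two-sided exponential random variables, i.e. each has density $\frac{1}{2}e^{-|x|}$, $x \in \mathbb{R}$. Let $a_1,\ldots,a_n$ be positive real numbers and let $S = \sum_{i=1}^n a_iX_i$. Put $$\alpha = \frac{\sqrt{\operatorname{Var}(S)}}{\max_{i \leq n} a_i} = \frac{\sqrt{2\sum_{i=1}^n a_i^2}}{\max_{i \leq n} a_i}$$ and $$h(u) = \sqrt{1+u^2}-1-\log\frac{1+\sqrt{1+u^2}}{2}, \qquad u > 0.$$ Then for every $t > 1$, $$\frac{1}{57}\,\frac{1}{\sqrt{\alpha t}}\exp(-\alpha t) \;\leq\; \mathbb{P}\left(S > t\sqrt{\operatorname{Var}(S)}\right) \;\leq\; \exp\left(-\frac{\alpha^2}{2}\,h\left(\frac{2t}{\alpha}\right)\right).$$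
   Context: $\log$ denotes the natural logarithm and $\operatorname{Var}$ denotes variance. *)

theory Defs
  imports "HOL-Probability.Probability"
begin

definition laplace_density :: "real \<Rightarrow> real" where
  "laplace_density x = 1 / 2 * exp (- \<bar>x\<bar>)"

definition rate_function :: "real \<Rightarrow> real" where
  "rate_function u = sqrt (1 + u\<^sup>2) - 1 - ln ((1 + sqrt (1 + u\<^sup>2)) / 2)"

end

theory Submission
  imports Defs
begin

text \<open>Let \<open>a\<^sub>k = m\<close> be the largest coefficient, so that the threshold is \<open>m * (\<alpha> * t)\<close>.
  For the lower bound, \<open>S\<close> exceeds it as soon as \<open>X\<^sub>k > \<alpha> * t\<close> and the sum of the other terms is
  nonnegative; these events are independent, and the latter has probability at least \<open>1 / 2\<close>
  by symmetry. This gives \<open>exp (- \<alpha> * t) / 4\<close>, and \<open>\<alpha> * t \<ge> 1\<close>. The upper bound is Chernoff's inequality: Bernoulli's inequality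
  \<open>(1 - \<theta>\<^sup>2) powr p \<le> 1 - p * \<theta>\<^sup>2\<close> with \<open>p = (a\<^sub>i / m)\<^sup>2\<close>
  bounds the moment generating function of \<open>S\<close> at \<open>\<theta> / m\<close> by
  \<open>(1 - \<theta>\<^sup>2) powr (- \<alpha>\<^sup>2 / 2)\<close>, and optimising over \<open>\<theta>\<close> yields the rate function.\<close>

section \<open>Integrals against the two-sided exponential density\<close>

lemma has_bochner_integral_laplace_density:
  fixes g :: "real \<Rightarrow> real"
  assumes [measurable]: "g \<in> borel_measurable borel"
    and u: "has_bochner_integral lborel (\<lambda>x. exponential_density 1 x * g x) u"
    and v: "has_bochner_integral lborel (\<lambda>x. exponential_density 1 x * g (- x)) v"
  shows "has_bochner_integral lborel (\<lambda>x. laplace_density x * g x) ((u + v) / 2)"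
proof -
  \<comment> \<open>The Laplace density is half the sum of the unit exponential density and its
    mirror image; substituting \<open>- x\<close> for \<open>x\<close> turns \<open>g (- x)\<close>
    into \<open>g x\<close> against the mirrored half.\<close>
  have "has_bochner_integral lborel (\<lambda>x. exponential_density 1 (- x) * g x) v"
    using lborel_has_bochner_integral_real_affine_iff[of "-1" "\<lambda>x. exponential_density 1 x * g (- x)" v 0] v
    by simp
  from has_bochner_integral_divide_zero[OF has_bochner_integral_add[OF u this], of 2]
  have *: "has_bochner_integral lborel
      (\<lambda>x. (exponential_density 1 x * g x + exponential_density 1 (- x) * g x) / 2) ((u + v) / 2)" .
  \<comment> \<open>At \<open>0\<close> both exponential densities equal 1, so the left side is
    twice \<open>laplace_density 0 * g 0\<close>; the identity holds off this null point.\<close>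
  have ae: "AE x in lborel. (exponential_density 1 x * g x + exponential_density 1 (- x) * g x) / 2
      = laplace_density x * g x"
    using AE_lborel_singleton[of 0]
    by eventually_elim (auto simp: exponential_density_def laplace_density_def)
  show ?thesis
    by (rule has_bochner_integralI_AE[OF *  _ ae]) (simp add: laplace_density_def)
qed

lemma has_bochner_integral_exponential_density_power:
  "has_bochner_integral lborel (\<lambda>x. exponential_density 1 x * x ^ i) (fact i)"
proof (rule has_bochner_integral_nn_integral)
  show "AE x in lborel. 0 \<le> exponential_density 1 x * x ^ i"
    by (auto simp: exponential_density_def)
  show "(\<integral>\<^sup>+ x. ennreal (exponential_density 1 x * x ^ i) \<partial>lborel) = ennreal (fact i)"
    using nn_integral_erlang_ith_moment[of 1 0 i] by simp
qed auto

lemma has_bochner_integral_exponential_density: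
  assumes "0 < l"
  shows "has_bochner_integral lborel (exponential_density l) 1"
proof (rule has_bochner_integral_nn_integral)
  show "(\<integral>\<^sup>+ x. ennreal (exponential_density l x) \<partial>lborel) = ennreal 1"
    using nn_integral_erlang_ith_moment[of l 0 0] assms by simp
qed (use assms in auto)

text \<open>Tilting the unit exponential density by \<open>exp (s * x)\<close> gives a multiple of
  the density of rate \<open>1 - s\<close>. Negative \<open>s\<close> is included, so both halves of
  the Laplace moment generating function are covered.\<close>

lemma has_bochner_integral_exponential_density_exp:
  assumes "s < 1"
  shows "has_bochner_integral lborel (\<lambda>x. exponential_density 1 x * exp (s * x)) (1 / (1 - s))"
proof -
  have "s * x - x = - (x * (1 - s))" for x
    by (simp add: algebra_simps)
  then have "exponential_density 1 x * exp (s * x) = exponential_density (1 - s) x / (1 - s)" for x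
    using assms by (simp add: exponential_density_def mult_exp_exp)
  then show ?thesis
    using has_bochner_integral_divide_zero[OF has_bochner_integral_exponential_density, of "1 - s" "1 - s"] assms
    by simp
qed

lemma has_bochner_integral_laplace_density_tail:
  assumes "0 \<le> y"
  shows "has_bochner_integral lborel (\<lambda>x. laplace_density x * indicator {y<..} x) (exp (- y) / 2)"
proof -
  have "has_bochner_integral lborel (\<lambda>x. exponential_density 1 (- y + 1 * x) * (exp (- y) / 2))
      (1 * (exp (- y) / 2))"
    using lborel_has_bochner_integral_real_affine_iff[of 1 "exponential_density 1" 1 "- y"]
      has_bochner_integral_exponential_density[of 1]
    by (intro has_bochner_integral_mult_left) simp
  then have *: "has_bochner_integral lborel (\<lambda>x. exponential_density 1 (- y + 1 * x) * (exp (- y) / 2))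
      (exp (- y) / 2)" by simp
  \<comment> \<open>Memorylessness: beyond \<open>y\<close> the Laplace density is
    \<open>exp (- y) / 2\<close> times a unit exponential density started at \<open>y\<close>. The
    two sides differ only at \<open>x = y\<close>, which the open ray excludes.\<close>
  have ae: "AE x in lborel. exponential_density 1 (- y + 1 * x) * (exp (- y) / 2)
      = laplace_density x * indicator {y<..} x"
    using AE_lborel_singleton[of y]
    by eventually_elim
      (use assms in \<open>auto simp: exponential_density_def laplace_density_def mult_exp_exp split: split_indicator\<close>)
  show ?thesis
    by (rule has_bochner_integralI_AE[OF * _ ae]) (simp add: laplace_density_def)
qed

lemma laplace_density_nonneg: "0 \<le> laplace_density x"
  by (simp add: laplace_density_def)

section \<open>Moments, moment generating function, tail and symmetry of one Laplace
  variable\<close>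

context prob_space
begin

lemma has_bochner_integral_laplace_distributed:
  fixes g :: "real \<Rightarrow> real"
  assumes "distributed M lborel X laplace_density" "g \<in> borel_measurable borel"
    and "has_bochner_integral lborel (\<lambda>x. laplace_density x * g x) u"
  shows "has_bochner_integral M (\<lambda>\<omega>. g (X \<omega>)) u"
  using distributed_integrable[OF assms(1), of g] distributed_integral[OF assms(1), of g] assms(2,3)
  by (simp add: has_bochner_integral_iff laplace_density_nonneg)

lemma laplace_distributed_mean:
  assumes "distributed M lborel X laplace_density"
  shows "has_bochner_integral M X 0"
  using has_bochner_integral_laplace_distributed[OF assms, of "\<lambda>x. x", OF _
      has_bochner_integral_laplace_density[of "\<lambda>x. x" 1 "-1"]]
    has_bochner_integral_exponential_density_power[of 1]
    has_bochner_integral_minus[OF has_bochner_integral_exponential_density_power[of 1]]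
  by simp

lemma laplace_distributed_second_moment:
  assumes "distributed M lborel X laplace_density"
  shows "has_bochner_integral M (\<lambda>\<omega>. (X \<omega>)\<^sup>2) 2"
  using has_bochner_integral_laplace_distributed[OF assms, of "\<lambda>x. x\<^sup>2", OF _
      has_bochner_integral_laplace_density[of "\<lambda>x. x\<^sup>2" 2 2]]
    has_bochner_integral_exponential_density_power[of 2]
  by (simp add: fact_numeral)

text \<open>The two half-lines contribute \<open>1 / (1 - s)\<close> and \<open>1 / (1 + s)\<close>,
  both finite because \<open>\<bar>s\<bar> < 1\<close>.\<close>

lemma laplace_distributed_mgf:
  assumes "distributed M lborel X laplace_density" "\<bar>s\<bar> < 1"
  shows "has_bochner_integral M (\<lambda>\<omega>. exp (s * X \<omega>)) (1 / (1 - s\<^sup>2))"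
proof -
  have "(1 / (1 - s) + 1 / (1 + s)) / 2 = 1 / (1 - s\<^sup>2)"
    using assms(2) square_diff_square_factored[of 1 s] by (simp add: add_frac_eq power2_eq_square)
  moreover have "has_bochner_integral M (\<lambda>\<omega>. exp (s * X \<omega>)) ((1 / (1 - s) + 1 / (1 + s)) / 2)"
    using has_bochner_integral_exponential_density_exp[of s]
      has_bochner_integral_exponential_density_exp[of "- s"] assms
    by (intro has_bochner_integral_laplace_distributed has_bochner_integral_laplace_density) auto
  ultimately show ?thesis
    by (simp only:)
qed

lemma laplace_distributed_tail:
  assumes D: "distributed M lborel X laplace_density" and "0 \<le> y"
  shows "prob {\<omega> \<in> space M. y < X \<omega>} = exp (- y) / 2"
proof -
  have [measurable]: "X \<in> borel_measurable M"
    using distributed_measurable[OF D] by simp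
  have "has_bochner_integral M (\<lambda>\<omega>. indicator {y<..} (X \<omega>) :: real) (exp (- y) / 2)"
    by (intro has_bochner_integral_laplace_distributed[OF D]
        has_bochner_integral_laplace_density_tail assms) simp
  then have "(\<integral>\<omega>. indicator {y<..} (X \<omega>) \<partial>M) = exp (- y) / 2"
    by (simp add: has_bochner_integral_iff)
  moreover have "(\<integral>\<omega>. indicator {y<..} (X \<omega>) \<partial>M)
      = (\<integral>\<omega>. indicator {\<omega> \<in> space M. y < X \<omega>} \<omega> \<partial>M :: real)"
    by (intro Bochner_Integration.integral_cong) (auto split: split_indicator)
  ultimately show ?thesis
    by simp
qed

text \<open>The density is even. Symmetry is phrased as an equality of laws so that it survives
  scaling and passes to product measures.\<close>

lemma laplace_distributed_symmetric:
  assumes D: "distributed M lborel X laplace_density"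
  shows "distr M borel (\<lambda>\<omega>. - X \<omega>) = distr M borel X"
proof -
  have "distributed M lborel (\<lambda>\<omega>. - X \<omega>) laplace_density"
    using distributed_affine[OF D, of "-1" 0] by (simp add: laplace_density_def divide_ennreal_def)
  from distributed_distr_eq_density[OF this] distributed_distr_eq_density[OF D]
  have "distr M lborel (\<lambda>\<omega>. - X \<omega>) = distr M lborel X" by simp
  then show ?thesis
    by (simp cong: distr_cong)
qed

section \<open>Sums of independent variables: second moment, symmetry and the lower bound for the
  tail\<close>

lemma second_moment_indep_sum:
  fixes Z :: "'i \<Rightarrow> 'a \<Rightarrow> real"
  assumes "finite I" "indep_vars (\<lambda>_. borel) Z I"
    and "\<And>i. i \<in> I \<Longrightarrow> has_bochner_integral M (Z i) 0"
    and "\<And>i. i \<in> I \<Longrightarrow> has_bochner_integral M (\<lambda>\<omega>. (Z i \<omega>)\<^sup>2) (v i)"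
  shows "has_bochner_integral M (\<lambda>\<omega>. (\<Sum>i\<in>I. Z i \<omega>)\<^sup>2) (\<Sum>i\<in>I. v i)"
  using assms
proof (induction I rule: finite_induct)
  case empty
  then show ?case by (simp add: has_bochner_integral_zero)
next
  case (insert i I)
  let ?Y = "\<lambda>\<omega>. \<Sum>i\<in>I. Z i \<omega>"
  have "indep_vars (\<lambda>_. borel) Z I"
    by (rule indep_vars_subset[OF insert.prems(1)]) auto
  then have Y2: "has_bochner_integral M (\<lambda>\<omega>. (?Y \<omega>)\<^sup>2) (\<Sum>i\<in>I. v i)"
    using insert.IH insert.prems by simp
  have Zi: "has_bochner_integral M (Z i) 0"
    using insert.prems by simp
  have Y: "has_bochner_integral M ?Y 0"
    using has_bochner_integral_sum[of I M Z "\<lambda>_. 0"] insert.prems by simp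
  have "indep_var borel (Z i) borel ?Y"
    by (rule indep_vars_sum[OF insert.hyps insert.prems(1)])
  \<comment> \<open>Independence factors the mean of the cross term into a product of two means,
    both 0.\<close>
  then have ZY: "has_bochner_integral M (\<lambda>\<omega>. Z i \<omega> * ?Y \<omega>) 0"
    using indep_var_lebesgue_integral[of "Z i" ?Y] indep_var_integrable[of "Z i" ?Y] Y Zi
    by (simp add: has_bochner_integral_iff)
  have "has_bochner_integral M (\<lambda>\<omega>. (Z i \<omega>)\<^sup>2 + (?Y \<omega>)\<^sup>2 + 2 * (Z i \<omega> * ?Y \<omega>))
      (v i + (\<Sum>i\<in>I. v i) + 2 * 0)"
    using insert.prems(3)[of i] Y2 ZY
    by (intro has_bochner_integral_add has_bochner_integral_mult_right) auto
  then show ?case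
    using insert.hyps by (simp add: power2_sum algebra_simps)
qed

text \<open>By independence the joint law is the product of the marginals, so flipping every sign
  preserves it, and the sum has the same law as its negative. At each point one of the two is
  nonnegative, so two equal probabilities add up to at least 1.\<close>

lemma prob_symmetric_sum_nonneg:
  fixes Z :: "'i \<Rightarrow> 'a \<Rightarrow> real"
  assumes "finite I" and indep: "indep_vars (\<lambda>_. borel) Z I"
    and sym: "\<And>i. i \<in> I \<Longrightarrow> distr M borel (\<lambda>\<omega>. - Z i \<omega>) = distr M borel (Z i)"
  shows "1 / 2 \<le> prob {\<omega> \<in> space M. 0 \<le> (\<Sum>i\<in>I. Z i \<omega>)}"
\<comment> \<open>The product-law characterisation of independence used below asks for a nonempty
  index set. The empty sum does occur later: for \<open>n = 1\<close> nothing remains beside the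
  largest term.\<close>
proof (cases "I = {}")
  case True
  then show ?thesis by (simp add: prob_space)
next
  case False
  let ?P = "PiM I (\<lambda>_. borel :: real measure)" and ?Y = "\<lambda>\<omega>. \<Sum>i\<in>I. Z i \<omega>"
  have rv: "random_variable borel (Z i)" if "i \<in> I" for i
    using indep that by (auto simp: indep_vars_def)
  note [measurable] = rv
  have indep': "indep_vars (\<lambda>_. borel) (\<lambda>i \<omega>. - Z i \<omega>) I"
    by (rule indep_vars_compose2[OF indep]) simp
  have "distr M ?P (\<lambda>\<omega>. \<lambda>i\<in>I. - Z i \<omega>) = PiM I (\<lambda>i. distr M borel (\<lambda>\<omega>. - Z i \<omega>))"
    using indep' by (subst (asm) indep_vars_iff_distr_eq_PiM'[OF False]) auto
  also have "\<dots> = PiM I (\<lambda>i. distr M borel (Z i))"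
    by (rule PiM_cong) (auto simp: sym)
  also have "\<dots> = distr M ?P (\<lambda>\<omega>. \<lambda>i\<in>I. Z i \<omega>)"
    using indep by (subst (asm) indep_vars_iff_distr_eq_PiM'[OF False]) auto
  finally have eq: "distr M ?P (\<lambda>\<omega>. \<lambda>i\<in>I. - Z i \<omega>) = distr M ?P (\<lambda>\<omega>. \<lambda>i\<in>I. Z i \<omega>)" .
  let ?A = "{f \<in> space ?P. 0 \<le> (\<Sum>i\<in>I. f i)}"
  have A: "?A \<in> sets ?P" by measurable
  have "prob {\<omega> \<in> space M. 0 \<le> (\<Sum>i\<in>I. - Z i \<omega>)} = measure (distr M ?P (\<lambda>\<omega>. \<lambda>i\<in>I. - Z i \<omega>)) ?A"
    by (subst measure_distr[OF _ A]) (auto intro!: arg_cong[where f = prob] simp: space_PiM)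
  also have "\<dots> = prob {\<omega> \<in> space M. 0 \<le> ?Y \<omega>}"
    unfolding eq
    by (subst measure_distr[OF _ A]) (auto intro!: arg_cong[where f = prob] simp: space_PiM)
  finally have "prob {\<omega> \<in> space M. 0 \<le> (\<Sum>i\<in>I. - Z i \<omega>)} = prob {\<omega> \<in> space M. 0 \<le> ?Y \<omega>}" .
  moreover have "prob (space M) \<le> prob ({\<omega> \<in> space M. 0 \<le> ?Y \<omega>} \<union> {\<omega> \<in> space M. 0 \<le> (\<Sum>i\<in>I. - Z i \<omega>)})"
    by (rule finite_measure_mono) (auto simp: sum_negf)
  moreover have "\<dots> \<le> prob {\<omega> \<in> space M. 0 \<le> ?Y \<omega>} + prob {\<omega> \<in> space M. 0 \<le> (\<Sum>i\<in>I. - Z i \<omega>)}"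
    by (rule measure_Un_le) auto
  ultimately show ?thesis
    by (simp add: prob_space)
qed

lemma laplace_sum_tail_ge:
  fixes a :: "'i \<Rightarrow> real"
  assumes "finite I" and indep: "indep_vars (\<lambda>_. borel) X I"
    and D: "\<And>i. i \<in> I \<Longrightarrow> distributed M lborel (X i) laplace_density"
    and k: "k \<in> I" "0 < a k" and "0 \<le> y"
  shows "exp (- y) / 4 \<le> prob {\<omega> \<in> space M. a k * y < (\<Sum>i\<in>I. a i * X i \<omega>)}"
proof -
  let ?J = "I - {k}" and ?Z = "\<lambda>i \<omega>. a i * X i \<omega>"
  let ?Y = "\<lambda>\<omega>. \<Sum>i\<in>?J. ?Z i \<omega>"
  have [measurable]: "X i \<in> borel_measurable M" if "i \<in> I" for i
    using distributed_measurable[OF D[OF that]] by simp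
  have indepZ: "indep_vars (\<lambda>_. borel) ?Z I"
    by (rule indep_vars_compose2[OF indep]) simp
  have sym: "distr M borel (\<lambda>\<omega>. - ?Z i \<omega>) = distr M borel (?Z i)" if "i \<in> I" for i
  proof -
    have "distr M borel (\<lambda>\<omega>. - ?Z i \<omega>) = distr (distr M borel (\<lambda>\<omega>. - X i \<omega>)) borel ((*) (a i))"
      using that by (subst distr_distr) (auto simp: o_def)
    also have "\<dots> = distr M borel (?Z i)"
      using that unfolding laplace_distributed_symmetric[OF D[OF that]]
      by (subst distr_distr) (auto simp: o_def)
    finally show ?thesis .
  qed
  have half: "1 / 2 \<le> prob {\<omega> \<in> space M. 0 \<le> ?Y \<omega>}"
    using \<open>finite I\<close> sym
    by (intro prob_symmetric_sum_nonneg indep_vars_subset[OF indepZ]) auto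
  have "indep_var borel (?Z k) borel ?Y"
    using \<open>finite I\<close> k(1) indepZ by (intro indep_vars_sum) (auto simp: insert_absorb)
  \<comment> \<open>The open ray for the term \<open>k\<close> and the closed ray for the rest make
    the full sum exceed \<open>a k * y\<close> strictly.\<close>
  from indep_varD[OF this, of "{a k * y<..}" "{0..}"]
  have "prob ((\<lambda>\<omega>. (?Z k \<omega>, ?Y \<omega>)) -` ({a k * y<..} \<times> {0..}) \<inter> space M)
      = prob (?Z k -` {a k * y<..} \<inter> space M) * prob (?Y -` {0..} \<inter> space M)"
    by simp
  moreover have "?Z k -` {a k * y<..} \<inter> space M = {\<omega> \<in> space M. y < X k \<omega>}"
    using k(2) by auto
  moreover have "?Y -` {0..} \<inter> space M = {\<omega> \<in> space M. 0 \<le> ?Y \<omega>}"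
    by auto
  ultimately have "exp (- y) / 2 * prob {\<omega> \<in> space M. 0 \<le> ?Y \<omega>}
      = prob ((\<lambda>\<omega>. (?Z k \<omega>, ?Y \<omega>)) -` ({a k * y<..} \<times> {0..}) \<inter> space M)"
    using laplace_distributed_tail[OF D[OF k(1)] \<open>0 \<le> y\<close>] by simp
  also have "\<dots> \<le> prob {\<omega> \<in> space M. a k * y < (\<Sum>i\<in>I. ?Z i \<omega>)}" (is "_ \<le> ?p")
    by (rule finite_measure_mono) (use \<open>finite I\<close> k(1) in \<open>auto simp: sum.remove[of I k]\<close>)
  finally have "exp (- y) / 2 * prob {\<omega> \<in> space M. 0 \<le> ?Y \<omega>} \<le> ?p" .
  moreover have "exp (- y) / 2 * (1 / 2) \<le> exp (- y) / 2 * prob {\<omega> \<in> space M. 0 \<le> ?Y \<omega>}"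
    by (rule mult_left_mono[OF half]) simp
  ultimately show ?thesis
    by linarith
qed

end

section \<open>Moment generating function of the sum and the optimal exponent\<close>

lemma powr_bernoulli_le:
  fixes y p :: real
  assumes "0 \<le> p" "p \<le> 1" "y < 1"
  shows "exp (p * ln (1 - y)) \<le> 1 - p * y"
proof -
  \<comment> \<open>Convexity of \<open>exp\<close> between the points \<open>0\<close> and
    \<open>ln (1 - y)\<close>, with weights \<open>1 - p\<close> and \<open>p\<close>.\<close>
  have "exp ((1 - p) *\<^sub>R 0 + p *\<^sub>R ln (1 - y)) \<le> (1 - p) * exp 0 + p * exp (ln (1 - y))"
    using assms by (intro convex_onD[OF exp_convex]) auto
  then show ?thesis
    using assms by (simp add: algebra_simps)
qed

text \<open>Dividing by \<open>m\<close> puts the coefficients into \<open>[-1, 1]\<close>: each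
  single generating function is then finite, and the Bernoulli exponents
  \<open>(b i)\<^sup>2\<close> are at most 1. All factors are bounded by powers of the same base
  \<open>1 - \<theta>\<^sup>2\<close>, so the bound on the product depends on the coefficients only
  through their normalised sum of squares.\<close>

lemma (in prob_space) laplace_sum_mgf_le:
  fixes a :: "'i \<Rightarrow> real"
  assumes "finite I" and indep: "indep_vars (\<lambda>_. borel) X I"
    and D: "\<And>i. i \<in> I \<Longrightarrow> distributed M lborel (X i) laplace_density"
    and a: "\<And>i. i \<in> I \<Longrightarrow> \<bar>a i\<bar> \<le> m" and m: "0 < m" and \<theta>: "0 \<le> \<theta>" "\<theta> < 1"
  shows "integrable M (\<lambda>\<omega>. exp (\<theta> / m * (\<Sum>i\<in>I. a i * X i \<omega>)))"
    and "expectation (\<lambda>\<omega>. exp (\<theta> / m * (\<Sum>i\<in>I. a i * X i \<omega>)))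
      \<le> exp (- ((\<Sum>i\<in>I. (a i)\<^sup>2) / m\<^sup>2 * ln (1 - \<theta>\<^sup>2)))"
proof -
  define b where "b i = a i / m" for i
  have b: "\<bar>b i\<bar> \<le> 1" if "i \<in> I" for i
    using a[OF that] m by (simp add: b_def)
  have b2: "(b i)\<^sup>2 \<le> 1" if "i \<in> I" for i
    using b[OF that] by (simp add: abs_square_le_1)
  have \<theta>2: "\<theta>\<^sup>2 < 1"
    using \<theta> by (simp add: abs_square_less_1)
  have E: "exp (\<theta> / m * (\<Sum>i\<in>I. a i * X i \<omega>)) = (\<Prod>i\<in>I. exp (\<theta> * b i * X i \<omega>))" for \<omega>
    using \<open>finite I\<close> by (simp add: exp_sum[symmetric] sum_distrib_left b_def field_simps)
  have "\<bar>\<theta> * b i\<bar> < 1" if "i \<in> I" for i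
    using mult_left_mono[OF b[OF that] \<theta>(1)] \<theta> by (simp add: abs_mult)
  then have mgf: "has_bochner_integral M (\<lambda>\<omega>. exp (\<theta> * b i * X i \<omega>)) (1 / (1 - (\<theta> * b i)\<^sup>2))"
    if "i \<in> I" for i
    using that by (intro laplace_distributed_mgf D)
  have indep': "indep_vars (\<lambda>_. borel) (\<lambda>i \<omega>. exp (\<theta> * b i * X i \<omega>)) I"
    by (rule indep_vars_compose2[OF indep]) simp
  show "integrable M (\<lambda>\<omega>. exp (\<theta> / m * (\<Sum>i\<in>I. a i * X i \<omega>)))"
    unfolding E using \<open>finite I\<close> indep' mgf
    by (intro indep_vars_integrable) (auto simp: has_bochner_integral_iff)
  have "expectation (\<lambda>\<omega>. exp (\<theta> / m * (\<Sum>i\<in>I. a i * X i \<omega>)))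
      = (\<Prod>i\<in>I. expectation (\<lambda>\<omega>. exp (\<theta> * b i * X i \<omega>)))"
    unfolding E using \<open>finite I\<close> indep' mgf
    by (intro indep_vars_lebesgue_integral) (auto simp: has_bochner_integral_iff)
  also have "\<dots> = (\<Prod>i\<in>I. 1 / (1 - (b i)\<^sup>2 * \<theta>\<^sup>2))"
    using mgf by (intro prod.cong) (auto simp: has_bochner_integral_iff power_mult_distrib mult.commute)
  also have "\<dots> \<le> (\<Prod>i\<in>I. exp (- ((b i)\<^sup>2 * ln (1 - \<theta>\<^sup>2))))"
  proof (rule prod_mono)
    fix i assume i: "i \<in> I"
    have "exp ((b i)\<^sup>2 * ln (1 - \<theta>\<^sup>2)) \<le> 1 - (b i)\<^sup>2 * \<theta>\<^sup>2"
      by (rule powr_bernoulli_le) (use b2[OF i] \<theta>2 in auto)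
    \<comment> \<open>Bernoulli's bound also yields positivity, since its left side is an
      exponential; this permits taking reciprocals.\<close>
    moreover from this have "0 < 1 - (b i)\<^sup>2 * \<theta>\<^sup>2"
      by (rule less_le_trans[rotated]) simp
    ultimately show "0 \<le> 1 / (1 - (b i)\<^sup>2 * \<theta>\<^sup>2) \<and>
        1 / (1 - (b i)\<^sup>2 * \<theta>\<^sup>2) \<le> exp (- ((b i)\<^sup>2 * ln (1 - \<theta>\<^sup>2)))"
      by (simp add: exp_minus field_simps)
  qed
  also have "\<dots> = exp (- ((\<Sum>i\<in>I. (a i)\<^sup>2) / m\<^sup>2 * ln (1 - \<theta>\<^sup>2)))"
    using \<open>finite I\<close>
    by (simp add: exp_sum[symmetric] sum_negf sum_distrib_right sum_divide_distrib b_def power_divide)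
  finally show "expectation (\<lambda>\<omega>. exp (\<theta> / m * (\<Sum>i\<in>I. a i * X i \<omega>)))
      \<le> exp (- ((\<Sum>i\<in>I. (a i)\<^sup>2) / m\<^sup>2 * ln (1 - \<theta>\<^sup>2)))" .
qed

text \<open>The witness \<open>\<theta>\<close> maximises \<open>\<theta> * u + ln (1 - \<theta>\<^sup>2)\<close> over \<open>(0, 1)\<close>,
  i.e. it solves \<open>u = 2 * \<theta> / (1 - \<theta>\<^sup>2)\<close>.\<close>

lemma rate_function_attained:
  assumes "0 < u"
  obtains \<theta> where "0 < \<theta>" "\<theta> < 1" "rate_function u = \<theta> * u + ln (1 - \<theta>\<^sup>2)"
proof
  \<comment> \<open>The equation for the maximiser is the quadratic
    \<open>u * \<theta>\<^sup>2 + 2 * \<theta> - u = 0\<close>, whose positive root is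
    \<open>(r - 1) / u\<close>.\<close>
  define r where "r = sqrt (1 + u\<^sup>2)"
  have r2: "r\<^sup>2 = 1 + u\<^sup>2" and "0 \<le> r"
    by (auto simp: r_def)
  have r: "1 < r"
    using assms by (simp add: r_def)
  have "r\<^sup>2 < (1 + u)\<^sup>2"
    unfolding r2 using assms by (simp add: power2_sum)
  then have "r < 1 + u"
    using assms by (simp add: power2_less_imp_less)
  then show "0 < (r - 1) / u" "(r - 1) / u < 1"
    using assms r by auto
  \<comment> \<open>This factorisation gives \<open>1 - \<theta>\<^sup>2 = 2 / (1 + r)\<close>, the
    source of the logarithm in the rate function; the remaining part is
    \<open>\<theta> * u = r - 1\<close>.\<close>
  have u2: "u\<^sup>2 = (r - 1) * (r + 1)"
    using r2 by (simp add: algebra_simps power2_eq_square)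
  have "((r - 1) / u)\<^sup>2 = (r - 1) / (r + 1)"
    unfolding power_divide u2 using r by (simp add: power2_eq_square)
  then have "1 - ((r - 1) / u)\<^sup>2 = inverse ((1 + r) / 2)"
    using r by (simp add: field_simps)
  then have "ln (1 - ((r - 1) / u)\<^sup>2) = - ln ((1 + r) / 2)"
    using r by (simp only: ln_inverse)
  then show "rate_function u = (r - 1) / u * u + ln (1 - ((r - 1) / u)\<^sup>2)"
    using assms by (simp add: rate_function_def r_def)
qed

section \<open>Variance of the weighted sum and the two tail bounds\<close>

theorem theorem1:
  fixes M :: "'w measure" and X :: "nat \<Rightarrow> 'w \<Rightarrow> real" and a :: "nat \<Rightarrow> real" and n :: nat
    and S :: "'w \<Rightarrow> real" and \<alpha> :: real
  assumes "prob_space M"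
    and "n \<ge> 1"
    and "prob_space.indep_vars M (\<lambda>_. borel) X {1..n}"
    and "\<And>i. i \<in> {1..n} \<Longrightarrow> distributed M lborel (X i) laplace_density"
    and "\<And>i. i \<in> {1..n} \<Longrightarrow> a i > 0"
  defines "S \<equiv> \<lambda>\<omega>. \<Sum>i=1..n. a i * X i \<omega>"
    and "\<alpha> \<equiv> sqrt (prob_space.variance M S) / Max (a ` {1..n})"
  shows "\<alpha> = sqrt (2 * (\<Sum>i=1..n. (a i)\<^sup>2)) / Max (a ` {1..n}) \<and>
    (\<forall>t>1.
      1 / 57 * (1 / sqrt (\<alpha> * t)) * exp (- \<alpha> * t)
        \<le> prob_space.prob M {\<omega> \<in> space M. S \<omega> > t * sqrt (prob_space.variance M S)} \<and>
      prob_space.prob M {\<omega> \<in> space M. S \<omega> > t * sqrt (prob_space.variance M S)}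
        \<le> exp (- (\<alpha>\<^sup>2 / 2) * rate_function (2 * t / \<alpha>)))"
proof -
  interpret prob_space M by fact
  note indep = assms(3) and D = assms(4) and pos = assms(5)
  define m where "m = Max (a ` {1..n})"
  define Q where "Q = (\<Sum>i=1..n. (a i)\<^sup>2)"
  have "m \<in> a ` {1..n}"
    unfolding m_def using \<open>n \<ge> 1\<close> by (intro Max_in) auto
  then obtain k where k: "k \<in> {1..n}" "a k = m"
    by auto
  have m: "0 < m"
    using pos[OF k(1)] k(2) by simp
  have am: "\<bar>a i\<bar> \<le> m" if "i \<in> {1..n}" for i
    using that pos[OF that] by (simp add: m_def)
  have "m\<^sup>2 \<le> Q"
    unfolding Q_def k(2)[symmetric] using k(1) by (intro member_le_sum) auto
  have meanZ: "has_bochner_integral M (\<lambda>\<omega>. a i * X i \<omega>) 0" if "i \<in> {1..n}" for i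
    using has_bochner_integral_mult_right[OF laplace_distributed_mean[OF D[OF that]], of "a i"] by simp
  have varZ: "has_bochner_integral M (\<lambda>\<omega>. (a i * X i \<omega>)\<^sup>2) ((a i)\<^sup>2 * 2)" if "i \<in> {1..n}" for i
    using has_bochner_integral_mult_right[OF laplace_distributed_second_moment[OF D[OF that]], of "(a i)\<^sup>2"]
    by (simp add: power_mult_distrib)
  have indepZ: "indep_vars (\<lambda>_. borel) (\<lambda>i \<omega>. a i * X i \<omega>) {1..n}"
    by (rule indep_vars_compose2[OF indep]) simp
  have "expectation S = 0"
    using has_bochner_integral_sum[of "{1..n}" M "\<lambda>i \<omega>. a i * X i \<omega>" "\<lambda>_. 0"] meanZ
    by (simp add: S_def has_bochner_integral_iff)
  moreover have "expectation (\<lambda>\<omega>. (S \<omega>)\<^sup>2) = 2 * Q"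
    using second_moment_indep_sum[OF _ indepZ meanZ varZ]
    by (simp add: S_def Q_def has_bochner_integral_iff sum_distrib_left mult.commute)
  ultimately have var: "variance S = 2 * Q"
    by simp
  have \<alpha>: "\<alpha> = sqrt (2 * Q) / m"
    by (simp add: \<alpha>_def var m_def)
  have "m \<le> sqrt (2 * Q)"
    using m \<open>m\<^sup>2 \<le> Q\<close> zero_le_power2[of m] by (intro real_le_rsqrt) linarith
  then have \<alpha>1: "1 \<le> \<alpha>"
    using m by (simp add: \<alpha>)
  have \<alpha>m: "sqrt (2 * Q) = m * \<alpha>"
    using m by (simp add: \<alpha>)
  \<comment> \<open>This identifies the exponent in the bound on the moment generating function with
    the prefactor of the rate function.\<close>
  have \<alpha>2: "Q / m\<^sup>2 = \<alpha>\<^sup>2 / 2"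
    using order_trans[OF zero_le_power2 \<open>m\<^sup>2 \<le> Q\<close>] by (simp add: \<alpha> power_divide)
  have "1 / 57 * (1 / sqrt (\<alpha> * t)) * exp (- \<alpha> * t) \<le> prob {\<omega> \<in> space M. t * sqrt (variance S) < S \<omega>}"
    (is ?lower)
    and "prob {\<omega> \<in> space M. t * sqrt (variance S) < S \<omega>} \<le> exp (- (\<alpha>\<^sup>2 / 2) * rate_function (2 * t / \<alpha>))"
    (is ?upper) if t: "1 < t" for t
  proof -
    have \<alpha>t: "1 \<le> \<alpha> * t"
      using mult_mono[OF \<alpha>1 less_imp_le[OF t]] \<alpha>1 by simp
    have thr: "t * sqrt (variance S) = m * (\<alpha> * t)"
      unfolding var \<alpha>m by simp
    \<comment> \<open>Since \<open>\<alpha> * t \<ge> 1\<close>, the factor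
      \<open>1 / sqrt (\<alpha> * t)\<close> is at most 1, and \<open>1 / 57\<close> lies below the
      \<open>1 / 4\<close> of the tail bound.\<close>
    have "1 / 57 * (1 / sqrt (\<alpha> * t)) \<le> 1 / 57 * (1 / 1)"
      using \<alpha>t by (intro mult_left_mono divide_left_mono) auto
    then have "1 / 57 * (1 / sqrt (\<alpha> * t)) * exp (- \<alpha> * t) \<le> 1 / 4 * exp (- \<alpha> * t)"
      by (intro mult_right_mono) auto
    also have "\<dots> \<le> prob {\<omega> \<in> space M. t * sqrt (variance S) < S \<omega>}"
      using laplace_sum_tail_ge[OF finite_atLeastAtMost indep D k(1), of a "\<alpha> * t"] pos[OF k(1)] \<alpha>t
      unfolding thr by (simp add: k(2) S_def)
    finally show ?lower .
    \<comment> \<open>With \<open>u = 2 * t / \<alpha>\<close> the Chernoff exponent \<open>-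
      \<theta> * \<alpha> * t - \<alpha>\<^sup>2 / 2 * ln (1 - \<theta>\<^sup>2)\<close> is
      \<open>- (\<alpha>\<^sup>2 / 2)\<close> times
      \<open>\<theta> * u + ln (1 - \<theta>\<^sup>2)\<close>.\<close>
    have "0 < 2 * t / \<alpha>"
      using t \<alpha>1 by simp
    then obtain \<theta> where \<theta>: "0 < \<theta>" "\<theta> < 1"
      "rate_function (2 * t / \<alpha>) = \<theta> * (2 * t / \<alpha>) + ln (1 - \<theta>\<^sup>2)"
      by (rule rate_function_attained)
    note mgf = laplace_sum_mgf_le[OF finite_atLeastAtMost indep D am m less_imp_le[OF \<theta>(1)] \<theta>(2)]
    have intS: "integrable M (\<lambda>\<omega>. exp (\<theta> / m * S \<omega>))"
      using mgf(1) by (simp add: S_def)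
    have [measurable]: "S \<in> borel_measurable M"
      unfolding S_def using meanZ[THEN borel_measurable_has_bochner_integral]
      by (rule borel_measurable_sum)
    have "prob {\<omega> \<in> space M. t * sqrt (variance S) < S \<omega>} \<le> prob {\<omega> \<in> space M. m * (\<alpha> * t) \<le> S \<omega>}"
      unfolding thr by (rule finite_measure_mono) auto
    also have "\<dots> \<le> exp (- (\<theta> / m) * (m * (\<alpha> * t))) * (\<integral>\<omega>\<in>space M. exp (\<theta> / m * S \<omega>) \<partial>M)"
      using \<theta>(1) m integrable_mult_indicator[OF sets.top intS]
      by (intro Chernoff_ineq_ge) (simp_all add: set_integrable_def)
    also have "(\<integral>\<omega>\<in>space M. exp (\<theta> / m * S \<omega>) \<partial>M) = expectation (\<lambda>\<omega>. exp (\<theta> / m * S \<omega>))"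
      using intS by (rule set_integral_space)
    also have "exp (- (\<theta> / m) * (m * (\<alpha> * t))) * \<dots>
        \<le> exp (- (\<theta> / m) * (m * (\<alpha> * t))) * exp (- (Q / m\<^sup>2 * ln (1 - \<theta>\<^sup>2)))"
      using mgf(2) by (intro mult_left_mono) (auto simp: S_def Q_def)
    also have "\<dots> = exp (- (\<alpha>\<^sup>2 / 2) * rate_function (2 * t / \<alpha>))"
      unfolding mult_exp_exp \<theta>(3) \<alpha>2
      using m \<alpha>1 by (simp add: field_simps power2_eq_square)
    finally show ?upper .
  qed
  then show ?thesis
    using \<alpha> by (simp add: m_def Q_def)
qed

end
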